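(* Let $r>0$ be an integer and $\underline{x}=(x_2,\ldots,x_r)$ a tuple of elements of $\{0,1\}$. Consider any $\Phi$-irreducible element $w\in\Gamma_{\underline{x}}$. Let $i_1,\ldots,i_k$ be the distinct elements of $J_w$, in any order. Then $w$ is conjugate to $a_{i_1}\cdots a_{i_k}$ under $W$.
   Context: Let $T$ be the infinite rooted regular binary tree whose vertices are the finite words over $\{0,1\}$, with root the empty word, each word $t$ being joined by an edge to the words $0t$ and $1t$. Level $n$ of $T$ is the set of words of length $n$. Let $W=\mathrm{Aut}(T)$ be the automorphism group of $T$ (products are compositions, $(uv)(t)=u(v(t))$), with identity element $1$. For $u,v\in W$, let $(u,v)\in W$ be the automorphism fixing the root and given by $t0\mapsto u(t)0$ and $t1\mapsto v(t)1$ for every word $t$. Let $\sigma\in W$ be the involution fixing the root with $t0\mapsto t1$ and $t1\mapsto t0$ for every word $t$. Then $W=(W\times W)\rtimes\langle\sigma\rangle$, so every $w\in W$ can be written uniquely as $(u,v)$ or as $(u,v)\,\sigma$. The first descendants of $w\in W$ are the elements $u$ and $v$ if $w=(u,v)$, respectively the single element $uv$ if $w=(u,v)\,\sigma$. For $n\ge1$, the first descendants of the $n$-th descendants of $w$ are the $(n+1)$-st descendants of $w$. $\mathrm{Desc}(w)$ is the set of all $n$-th descendants of $w$ for all $n\ge1$. An element $w$ is called $\Phi$-irreducible if $\mathrm{Desc}(w)$ is finite and $w\in\mathrm{Desc}(w)$. Let $b_1,\ldots,b_r\in W$ be the elements determined by the recursion relations $b_1=(1,b_r)\,\sigma$; $b_i=(b_{i-1},1)$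 for all $2\le i\le r$ with $x_i=0$; $b_i=(1,b_{i-1})$ for all $2\le i\le r$ with $x_i=1$. Let $\Gamma_{\underline{x}}\subset W$ be the subgroup generated by $b_1,\ldots,b_r$. Let $a_1,\ldots,a_r\in W$ be the elements determined by the recursion relations $a_1=(a_r,1)\,\sigma$ and $a_i=(a_{i-1},1)$ for all $2\le i\le r$. For $w\in W$ and $n\ge 0$ let $\mathrm{sgn}_n(w)\in\{\pm1\}$ be the sign of the permutation of level $n$ induced by $w$, and for $w\in\Gamma_{\underline{x}}$ set $J_w:=\{1\le i\le r\mid\mathrm{sgn}_i(w)=-1\}$. *)

theory Defs
  imports "HOL-Algebra.Generated_Groups" "HOL-Combinatorics.Permutations"
begin

text \<open>Vertices are words over \<open>{0,1}\<close>, encoded as \<open>bool list\<close> with \<open>False\<close> for the letter 0 and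
  \<open>True\<close> for the letter 1. A word is written from left to right, and the children of \<open>t\<close> are
  \<open>0t\<close> and \<open>1t\<close>; so the \<^emph>\<open>last\<close> letter of a word tells which of the two subtrees below
  the root it lies in.\<close>

definition adj :: "bool list \<Rightarrow> bool list \<Rightarrow> bool" where
  "adj s t \<longleftrightarrow> (\<exists>c. t = c # s) \<or> (\<exists>c. s = c # t)"

text \<open>The root is the only vertex of degree 2, so a graph automorphism fixes it anyway; the condition
  \<open>w [] = []\<close> just records that the tree is rooted.\<close>

definition tree_aut :: "(bool list \<Rightarrow> bool list) set" where
  "tree_aut = {w. bij w \<and> w [] = [] \<and> (\<forall>s t. adj (w s) (w t) \<longleftrightarrow> adj s t)}"

definition W :: "(bool list \<Rightarrow> bool list) monoid" where
  "W = \<lparr>carrier = tree_aut, monoid.mult = (\<circ>), one = id\<rparr>"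

definition pair :: "(bool list \<Rightarrow> bool list) \<Rightarrow> (bool list \<Rightarrow> bool list) \<Rightarrow> bool list \<Rightarrow> bool list" where
  "pair u v s =
    (if s = [] then [] else (if last s then v (butlast s) else u (butlast s)) @ [last s])"

definition \<sigma> :: "bool list \<Rightarrow> bool list" where
  "\<sigma> s = (if s = [] then [] else butlast s @ [\<not> last s])"

lemma pair_simps [simp]:
  "pair u v [] = []"
  "pair u v (t @ [False]) = u t @ [False]"
  "pair u v (t @ [True]) = v t @ [True]"
  by (simp_all add: pair_def)

lemma sigma_simps [simp]:
  "\<sigma> [] = []"
  "\<sigma> (t @ [False]) = t @ [True]"
  "\<sigma> (t @ [True]) = t @ [False]"
  by (simp_all add: \<sigma>_def)

lemma W_simps [simp]:
  "carrier W = tree_aut" "u \<otimes>\<^bsub>W\<^esub> v = u \<circ> v" "\<one>\<^bsub>W\<^esub> = id"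
  by (simp_all add: W_def)

lemma group_W: "group W"
proof (rule groupI)
  fix w assume "w \<in> carrier W"
  then have w: "bij w" "w [] = []" "\<And>s t. adj (w s) (w t) \<longleftrightarrow> adj s t"
    by (simp_all add: tree_aut_def)
  let ?v = "inv_into UNIV w"
  have wv: "w (?v s) = s" for s
    using w(1) by (simp add: bij_is_surj surj_f_inv_f)
  have "bij ?v" using w(1) by (rule bij_imp_bij_inv)
  moreover have "?v [] = []"
    using w(1,2) by (simp add: bij_is_inj inv_f_eq)
  moreover have "adj (?v s) (?v t) \<longleftrightarrow> adj s t" for s t
    using w(3)[of "?v s" "?v t"] by (simp add: wv)
  ultimately have "?v \<in> tree_aut" by (simp add: tree_aut_def)
  moreover have "?v \<circ> w = id"
    using w(1) by (simp add: bij_is_inj)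
  ultimately show "\<exists>v\<in>carrier W. v \<otimes>\<^bsub>W\<^esub> w = \<one>\<^bsub>W\<^esub>"
    by auto
qed (auto simp: tree_aut_def bij_comp o_assoc)

text \<open>Every element of \<open>W\<close> is uniquely of the form \<open>(u,v)\<close> or \<open>(u,v)\<sigma>\<close> with \<open>u\<close> and \<open>v\<close> in \<open>W\<close>, so for each
  \<open>w\<close> in \<open>W\<close> exactly one of the two sets in the union is nonempty.\<close>

definition first_descendants :: "(bool list \<Rightarrow> bool list) \<Rightarrow> (bool list \<Rightarrow> bool list) set" where
  "first_descendants w =
    {d. \<exists>u\<in>carrier W. \<exists>v\<in>carrier W. w = pair u v \<and> (d = u \<or> d = v)} \<union>
    {d. \<exists>u\<in>carrier W. \<exists>v\<in>carrier W. w = pair u v \<otimes>\<^bsub>W\<^esub> \<sigma> \<and> d = u \<otimes>\<^bsub>W\<^esub> v}"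

fun descendants :: "nat \<Rightarrow> (bool list \<Rightarrow> bool list) \<Rightarrow> (bool list \<Rightarrow> bool list) set" where
  "descendants 0 w = {w}"
| "descendants (Suc n) w = (\<Union>d\<in>descendants n w. first_descendants d)"

definition Desc :: "(bool list \<Rightarrow> bool list) \<Rightarrow> (bool list \<Rightarrow> bool list) set" where
  "Desc w = (\<Union>n\<in>{1..}. descendants n w)"

definition \<Phi>_irreducible :: "(bool list \<Rightarrow> bool list) \<Rightarrow> bool" where
  "\<Phi>_irreducible w \<longleftrightarrow> finite (Desc w) \<and> w \<in> Desc w"

definition sgn_level :: "nat \<Rightarrow> (bool list \<Rightarrow> bool list) \<Rightarrow> int" where
  "sgn_level n w = sign_on {t. length t = n} w"

definition J :: "nat \<Rightarrow> (bool list \<Rightarrow> bool list) \<Rightarrow> nat set" where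
  "J r w = {i \<in> {1..r}. sgn_level i w = -1}"

end

theory Submission
  imports Defs
begin

text \<open>
  Word length with respect to the generators \<open>b\<^sub>i\<close> and their inverses does not increase under taking
  first descendants, so it is constant along a cycle of descendants through \<open>w\<close>. If \<open>d\<close> is
  followed by \<open>d'\<close> on such a cycle, then \<open>d = (u,v)\<close> forces the entry other than \<open>d'\<close> to have length 0;
  hence \<open>d\<close> is conjugate to \<open>(d',1)\<close> or to \<open>(d',1)\<sigma>\<close>. The signs satisfy \<open>sgn\<^sub>n\<^sub>+\<^sub>1(d) = sgn\<^sub>n(d')\<close> and are
  \<open>r\<close>-periodic, so \<open>J\<close> of \<open>d'\<close> is the cyclic shift of \<open>J\<close> of \<open>d\<close>, and \<open>1 \<in> J\<close> of \<open>d\<close> decides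
  between the two cases. Products of distinct \<open>a\<^sub>i\<close>, in any order, obey the same recursion, and this
  recursion determines an element up to conjugacy.
\<close>

section \<open>Tree automorphisms\<close>

text \<open>Going down the tree, injectivity keeps the image of a child off the image of its
  grandparent, so children go to children. The conditions on \<open>length\<close> and
  \<open>tl\<close> are the ones that later membership proofs verify.\<close>

lemma tree_aut_iff:
  "w \<in> tree_aut \<longleftrightarrow>
    bij w \<and> (\<forall>s. length (w s) = length s) \<and> (\<forall>c s. tl (w (c # s)) = w s)"
proof
  assume "w \<in> tree_aut"
  then have w: "bij w" "w [] = []" "\<And>s t. adj (w s) (w t) \<longleftrightarrow> adj s t"
    by (auto simp: tree_aut_def)
  have child: "\<exists>d. w (c # s) = d # w s" for c s
  proof (induction s arbitrary: c)
    case Nil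
    have "adj (w []) (w [c])"
      by (simp add: w(3)) (simp add: adj_def)
    then show ?case
      using w(2) by (auto simp: adj_def)
  next
    case (Cons e s)
    have "adj (w (e # s)) (w (c # e # s))"
      by (simp add: w(3)) (simp add: adj_def)
    moreover have "w (c # e # s) \<noteq> w s"
      using inj_eq[OF bij_is_inj[OF w(1)], of "c # e # s" s]
      by (auto dest: arg_cong[where f = length])
    ultimately show ?case
      using Cons[of e] by (auto simp: adj_def)
  qed
  have "length (w s) = length s" for s
  proof (induction s)
    case (Cons c s)
    then show ?case using child[of c s] by auto
  qed (simp add: w(2))
  moreover have "tl (w (c # s)) = w s" for c s
    using child[of c s] by auto
  ultimately show "bij w \<and> (\<forall>s. length (w s) = length s) \<and> (\<forall>c s. tl (w (c # s)) = w s)"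
    using w(1) by blast
next
  assume "bij w \<and> (\<forall>s. length (w s) = length s) \<and> (\<forall>c s. tl (w (c # s)) = w s)"
  then have w: "bij w" "\<And>s. length (w s) = length s" "\<And>c s. tl (w (c # s)) = w s"
    by auto
  have child: "\<exists>d. w (c # s) = d # w s" for c s
    using w(2)[of "c # s"] w(3)[of c s] by (cases "w (c # s)") auto
  have parent: "\<exists>c. t = c # s" if "w t = c # w s" for s t c
  proof (cases t)
    case Nil
    then show ?thesis using w(2)[of t] that by simp
  next
    case (Cons e t')
    then have "w t' = w s"
      using w(3)[of e t'] that by simp
    then show ?thesis
      using Cons w(1) by (auto simp: bij_def inj_def)
  qed
  have "adj (w s) (w t) \<longleftrightarrow> adj s t" for s t
  proof
    show "adj s t" if "adj (w s) (w t)"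
      using that parent by (auto simp: adj_def)
    show "adj (w s) (w t)" if "adj s t"
      using that child by (auto simp: adj_def)
  qed
  moreover have "w [] = []"
    using w(2)[of "[]"] by simp
  ultimately show "w \<in> tree_aut"
    using w(1) by (simp add: tree_aut_def)
qed

lemma tree_aut_bij: "w \<in> tree_aut \<Longrightarrow> bij w"
  and tree_aut_length [simp]: "w \<in> tree_aut \<Longrightarrow> length (w s) = length s"
  and tree_aut_tl: "w \<in> tree_aut \<Longrightarrow> tl (w (c # s)) = w s"
  by (simp_all add: tree_aut_iff)

lemma tree_aut_Nil [simp]: "w \<in> tree_aut \<Longrightarrow> w [] = []"
  by (simp add: tree_aut_def)

lemma id_in_tree_aut [simp]: "id \<in> tree_aut"
  by (simp add: tree_aut_iff)

lemma comp_in_tree_aut [simp]: "u \<in> tree_aut \<Longrightarrow> v \<in> tree_aut \<Longrightarrow> u \<circ> v \<in> tree_aut"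
  using monoid.m_closed[OF group.is_monoid[OF group_W], of u v] by simp

lemma inv_in_tree_aut [simp]: "w \<in> tree_aut \<Longrightarrow> inv\<^bsub>W\<^esub> w \<in> tree_aut"
  using group.inv_closed[OF group_W, of w] by simp

lemma inv_comp_tree_aut [simp]:
  assumes "w \<in> tree_aut"
  shows "inv\<^bsub>W\<^esub> w \<circ> w = id" "w \<circ> inv\<^bsub>W\<^esub> w = id"
  using group.l_inv[OF group_W, of w] group.r_inv[OF group_W, of w] assms by simp_all

section \<open>Calculus of pairs and of the involution at the root\<close>

lemma pair_snoc: "pair u v (t @ [c]) = (if c then v t else u t) @ [c]"
  by (cases c) simp_all

lemma sigma_snoc: "\<sigma> (t @ [c]) = t @ [\<not> c]"
  by (cases c) simp_all

lemma snoc_ext: "f [] = g [] \<Longrightarrow> (\<And>t c. f (t @ [c]) = g (t @ [c])) \<Longrightarrow> f = g"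
  by (metis ext rev_exhaust)

lemma pair_comp: "pair u v \<circ> pair u' v' = pair (u \<circ> u') (v \<circ> v')"
  by (rule snoc_ext) (simp_all add: pair_snoc)

lemma sigma_pair: "\<sigma> \<circ> pair u v = pair v u \<circ> \<sigma>"
  by (rule snoc_ext) (auto simp add: pair_snoc sigma_snoc)

lemma sigma_sigma [simp]: "\<sigma> \<circ> \<sigma> = id"
  by (rule snoc_ext) (auto simp add: sigma_snoc)

lemma pair_id [simp]: "pair id id = id"
  by (rule snoc_ext) (auto simp add: pair_snoc)

lemma pair_eq_iff: "pair u v = pair u' v' \<longleftrightarrow> u = u' \<and> v = v'"
proof
  assume eq: "pair u v = pair u' v'"
  have "u t = u' t" "v t = v' t" for t
    using fun_cong[OF eq, of "t @ [False]"] fun_cong[OF eq, of "t @ [True]"]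
    by simp_all
  then show "u = u' \<and> v = v'" by auto
qed auto

lemma pair_neq_pair_sigma: "pair u v \<noteq> pair u' v' \<circ> \<sigma>"
proof
  assume "pair u v = pair u' v' \<circ> \<sigma>"
  from fun_cong[OF this, of "[] @ [False]"] show False
    by (simp add: sigma_snoc pair_snoc del: append_Nil)
qed

lemma pair_sigma_eq_iff: "pair u v \<circ> \<sigma> = pair u' v' \<circ> \<sigma> \<longleftrightarrow> u = u' \<and> v = v'"
proof
  assume "pair u v \<circ> \<sigma> = pair u' v' \<circ> \<sigma>"
  then have "pair u v \<circ> \<sigma> \<circ> \<sigma> = pair u' v' \<circ> \<sigma> \<circ> \<sigma>" by simp
  then show "u = u' \<and> v = v'" by (simp add: comp_assoc pair_eq_iff)
qed auto

lemma pair_in_tree_aut [simp]: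
  assumes "u \<in> tree_aut" "v \<in> tree_aut"
  shows "pair u v \<in> tree_aut"
proof -
  have "bij (pair u v)"
    by (rule o_bij[of "pair (inv\<^bsub>W\<^esub> u) (inv\<^bsub>W\<^esub> v)"]) (simp_all add: pair_comp assms)
  moreover have "length (pair u v s) = length s" for s
    by (cases s rule: rev_cases) (simp_all add: pair_snoc assms)
  moreover have "tl (pair u v (c # s)) = pair u v s" for c s
  proof (cases s rule: rev_cases)
    case Nil
    then show ?thesis
      using pair_snoc[of u v "[]" c] assms by simp
  next
    case (snoc t d)
    have "u (c # t) \<noteq> []" "v (c # t) \<noteq> []"
      using assms by (metis tree_aut_length length_0_conv list.distinct(1))+
    then show ?thesis
      using snoc pair_snoc[of u v "c # t" d] assms by (simp add: pair_snoc tree_aut_tl)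
  qed
  ultimately show ?thesis by (simp add: tree_aut_iff)
qed

lemma sigma_in_tree_aut [simp]: "\<sigma> \<in> tree_aut"
proof -
  have "bij \<sigma>"
    by (rule o_bij[of \<sigma>]) simp_all
  moreover have "length (\<sigma> s) = length s" for s
    by (cases s rule: rev_cases) (simp_all add: sigma_snoc)
  moreover have "tl (\<sigma> (c # s)) = \<sigma> s" for c s
    by (simp add: \<sigma>_def)
  ultimately show ?thesis by (simp add: tree_aut_iff)
qed

section \<open>Conjugacy\<close>

text \<open>The intertwining equation contains no inverse, so it can be tested one word at a
  time.\<close>

definition conjugate :: "(bool list \<Rightarrow> bool list) \<Rightarrow> (bool list \<Rightarrow> bool list) \<Rightarrow> bool" where
  "conjugate u v \<longleftrightarrow> (\<exists>g\<in>tree_aut. u \<circ> g = g \<circ> v)"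

lemma conjugateI: "g \<in> tree_aut \<Longrightarrow> u \<circ> g = g \<circ> v \<Longrightarrow> conjugate u v"
  by (auto simp: conjugate_def)

lemma conjugate_refl [simp]: "conjugate u u"
  by (rule conjugateI[of id]) simp_all

lemma conjugate_sym:
  assumes "conjugate u v"
  shows "conjugate v u"
proof -
  obtain g where g: "g \<in> tree_aut" "u \<circ> g = g \<circ> v"
    using assms by (auto simp: conjugate_def)
  have "v \<circ> inv\<^bsub>W\<^esub> g = inv\<^bsub>W\<^esub> g \<circ> (g \<circ> v) \<circ> inv\<^bsub>W\<^esub> g"
    using g(1) by (simp flip: comp_assoc)
  also have "\<dots> = inv\<^bsub>W\<^esub> g \<circ> u \<circ> (g \<circ> inv\<^bsub>W\<^esub> g)"
    by (simp only: comp_assoc flip: g(2))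
  finally show ?thesis
    using g(1) by (intro conjugateI[of "inv\<^bsub>W\<^esub> g"]) simp_all
qed

lemma conjugate_W:
  assumes "conjugate u v"
  shows "\<exists>g\<in>carrier W. u = g \<otimes>\<^bsub>W\<^esub> v \<otimes>\<^bsub>W\<^esub> inv\<^bsub>W\<^esub> g"
proof -
  obtain g where g: "g \<in> tree_aut" "u \<circ> g = g \<circ> v"
    using assms by (auto simp: conjugate_def)
  have "g \<circ> v \<circ> inv\<^bsub>W\<^esub> g = u \<circ> (g \<circ> inv\<^bsub>W\<^esub> g)"
    by (simp only: comp_assoc flip: g(2))
  then show ?thesis
    using g(1) by (intro bexI[of _ g]) simp_all
qed

text \<open>Normal form for one step of the recursion: at most one nontrivial entry, with
  \<open>s\<close> recording whether the two subtrees at the root are exchanged.\<close>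

definition root_ext :: "bool \<Rightarrow> (bool list \<Rightarrow> bool list) \<Rightarrow> bool list \<Rightarrow> bool list" where
  "root_ext s u = pair u id \<circ> (if s then \<sigma> else id)"

lemma root_ext_in_tree_aut [simp]: "u \<in> tree_aut \<Longrightarrow> root_ext s u \<in> tree_aut"
  by (simp add: root_ext_def)

lemma conjugate_root_ext_right: "conjugate (pair id u) (root_ext False u)"
  by (rule conjugateI[of \<sigma>]) (simp_all add: root_ext_def sigma_pair)

text \<open>Since \<open>\<sigma> (1,v) = (v,1) \<sigma>\<close>, conjugation by
  \<open>(1,v)\<close> collects the product of both entries in the first one.\<close>

lemma conjugate_root_ext_swap:
  assumes "v \<in> tree_aut"
  shows "conjugate (pair u v \<circ> \<sigma>) (root_ext True (u \<circ> v))"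
proof (rule conjugateI[of "pair id v"])
  have "pair u v \<circ> \<sigma> \<circ> pair id v = pair u v \<circ> pair v id \<circ> \<sigma>"
    by (simp add: comp_assoc sigma_pair)
  then show "pair u v \<circ> \<sigma> \<circ> pair id v = pair id v \<circ> root_ext True (u \<circ> v)"
    by (simp add: root_ext_def pair_comp flip: comp_assoc)
qed (simp add: assms)

text \<open>The diagonal element \<open>(g,g)\<close> commutes with \<open>\<sigma>\<close>, so
  intertwining up to level \<open>n\<close> in the entries becomes intertwining up to level
  \<open>n + 1\<close>.\<close>

lemma root_ext_pair_diag:
  assumes "\<And>s. length s \<le> n \<Longrightarrow> u (g s) = g (u' s)" "length s \<le> Suc n"
  shows "root_ext e u (pair g g s) = pair g g (root_ext e u' s)"
  using assms
  by (cases s rule: rev_cases) (auto simp: root_ext_def pair_snoc sigma_snoc)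

text \<open>The conjugator is built level by level: if \<open>w k = k F(u)\<close> and \<open>F(u') l = l w'\<close>, with \<open>F\<close> the
  same root extension on both sides, and \<open>g\<close> conjugates \<open>u\<close> to \<open>u'\<close> up to level \<open>n\<close>, then
  \<open>k (g,g) l\<close> conjugates \<open>w\<close> to \<open>w'\<close> up to level \<open>n + 1\<close>.\<close>

lemma conjugate_coinduct:
  assumes "R w w'"
    and R: "\<And>w w'. R w w' \<Longrightarrow> w \<in> tree_aut \<and> w' \<in> tree_aut \<and>
      (\<exists>s u u'. R u u' \<and> conjugate w (root_ext s u) \<and> conjugate w' (root_ext s u'))"
  shows "conjugate w w'"
proof -
  define Rp where "Rp p \<longleftrightarrow> R (fst p) (snd p)" for p
  \<comment> \<open>With \<open>Rp p\<close> as a premise the choices exist for every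
    \<open>p\<close> and turn into functions of \<open>p\<close>. The second conjugacy is taken in
    reverse, so that \<open>l p\<close> ends up on the right of the conjugator.\<close>
  have "\<forall>p. \<exists>q k l s. Rp p \<longrightarrow> Rp q \<and> k \<in> tree_aut \<and> l \<in> tree_aut \<and>
      fst p \<circ> k = k \<circ> root_ext s (fst q) \<and> root_ext s (snd q) \<circ> l = l \<circ> snd p"
  proof
    fix p
    show "\<exists>q k l s. Rp p \<longrightarrow> Rp q \<and> k \<in> tree_aut \<and> l \<in> tree_aut \<and>
      fst p \<circ> k = k \<circ> root_ext s (fst q) \<and> root_ext s (snd q) \<circ> l = l \<circ> snd p"
    proof (cases "Rp p")
      case True
      then obtain s u u' where u: "R u u'" "conjugate (fst p) (root_ext s u)"
          "conjugate (root_ext s u') (snd p)"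
        using R[of "fst p" "snd p"] conjugate_sym unfolding Rp_def by blast
      then show ?thesis
        unfolding conjugate_def Rp_def by (metis fst_conv snd_conv)
    qed simp
  qed
  then obtain q k l s where step: "\<And>p. Rp p \<Longrightarrow> Rp (q p) \<and> k p \<in> tree_aut \<and> l p \<in> tree_aut \<and>
      fst p \<circ> k p = k p \<circ> root_ext (s p) (fst (q p)) \<and>
      root_ext (s p) (snd (q p)) \<circ> l p = l p \<circ> snd p"
    by metis
  \<comment> \<open>The recursion produces functions of \<open>p\<close>, because stage
    \<open>n + 1\<close> at \<open>p\<close> calls stage \<open>n\<close> at the successor pair
    \<open>q p\<close>.\<close>
  define G where "G = rec_nat (\<lambda>p. id) (\<lambda>n g p. k p \<circ> pair (g (q p)) (g (q p)) \<circ> l p)"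
  have G0: "G 0 = (\<lambda>p. id)" and
    GS: "G (Suc n) p = k p \<circ> pair (G n (q p)) (G n (q p)) \<circ> l p" for n p
    by (simp_all add: G_def)
  have G_aut: "G n p \<in> tree_aut" if "Rp p" for n p
    using that by (induction n arbitrary: p) (simp_all add: G0 GS step)
  \<comment> \<open>Consecutive stages agree up to level \<open>n\<close>, so the stages have a
    limit.\<close>
  have G_stable: "G (Suc n) p t = G n p t" if "Rp p" "length t \<le> n" for n p t
    using that
  proof (induction n arbitrary: p t)
    case 0
    then show ?case using G_aut[of p "Suc 0"] by (simp add: G0)
  next
    case (Suc n)
    have "pair (G (Suc n) (q p)) (G (Suc n) (q p)) s = pair (G n (q p)) (G n (q p)) s"
      if "length s \<le> Suc n" for s
      using that Suc.IH[of "q p"] step[OF Suc.prems(1)]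
      by (cases s rule: rev_cases) (auto simp: pair_snoc)
    then show ?case
      using Suc.prems step[OF Suc.prems(1)] GS[of "Suc n" p] GS[of n p] by simp
  qed
  have G_conj: "fst p (G n p t) = G n p (snd p t)" if "Rp p" "length t \<le> n" for n p t
    using that
  proof (induction n arbitrary: p t)
    case 0
    then show ?case using R[of "fst p" "snd p"] by (simp add: G0 Rp_def)
  next
    case (Suc n)
    let ?g = "pair (G n (q p)) (G n (q p))"
    note st = step[OF Suc.prems(1)]
    have "fst p (G (Suc n) p t) = k p (root_ext (s p) (fst (q p)) (?g (l p t)))"
      using st by (simp add: GS fun_eq_iff)
    also have "\<dots> = k p (?g (root_ext (s p) (snd (q p)) (l p t)))"
      using st Suc by (subst root_ext_pair_diag[where n = n and u' = "snd (q p)"]) auto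
    also have "\<dots> = G (Suc n) p (snd p t)"
      using st by (simp add: GS fun_eq_iff)
    finally show ?case .
  qed
  define p where "p = (w, w')"
  have p: "Rp p" using assms(1) by (simp add: p_def Rp_def)
  \<comment> \<open>The limit: each word is evaluated at the stage given by its length, and all
    later stages have the same value there.\<close>
  define g where "g t = G (length t) p t" for t
  have G_eq: "G n p t = g t" if "length t \<le> n" for n t
    using that by (induction rule: dec_induct) (simp_all add: g_def G_stable p)
  have len_g [simp]: "length (g t) = length t" for t
    by (simp add: g_def G_aut p)
  have "inj g"
  proof (rule injI)
    fix s t assume eq: "g s = g t"
    then have "length s = length t" by (metis len_g)
    then show "s = t"
      using eq tree_aut_bij[OF G_aut[OF p, of "length t"]] by (simp add: g_def bij_def inj_def)
  qed
  moreover have "t \<in> range g" for t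
  proof -
    obtain s where s: "t = G (length t) p s"
      using tree_aut_bij[OF G_aut[OF p, of "length t"]] by (metis bij_def surjD)
    then have "length s = length t" by (metis G_aut p tree_aut_length)
    then show ?thesis
      using s by (intro range_eqI[of _ _ s]) (simp add: g_def)
  qed
  moreover have "tl (g (c # t)) = g t" for c t
    using tree_aut_tl[OF G_aut[OF p, of "Suc (length t)"], of c t]
    by (simp add: G_eq)
  ultimately have g: "g \<in> tree_aut"
    by (auto simp: tree_aut_iff bij_def)
  have "w (g t) = g (w' t)" for t
    using G_conj[OF p, of t "length t"] R[OF assms(1)] by (simp add: g_def p_def)
  then show ?thesis
    by (intro conjugateI[OF g]) auto
qed

section \<open>Signs on levels\<close>

lemma finite_level [simp]: "finite {t :: bool list. length t = n}"
  using finite_lists_length_eq[of "UNIV :: bool set" n] by simp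

lemma bij_betw_level:
  assumes "w \<in> tree_aut"
  shows "bij_betw w {t. length t = n} {t. length t = n}"
proof -
  have "inj_on w {t. length t = n}"
    using tree_aut_bij[OF assms] by (meson bij_is_inj inj_on_subset subset_UNIV)
  moreover have "w ` {t. length t = n} \<subseteq> {t. length t = n}"
    using assms by auto
  ultimately show ?thesis
    by (simp add: bij_betw_def endo_inj_surj)
qed

lemma sgn_level_comp:
  "u \<in> tree_aut \<Longrightarrow> v \<in> tree_aut \<Longrightarrow> sgn_level n (u \<circ> v) = sgn_level n u * sgn_level n v"
  unfolding sgn_level_def by (intro sign_on_compose bij_betw_level finite_level)

lemma sgn_level_id [simp]: "sgn_level n id = 1"
  by (simp add: sgn_level_def)

lemma sgn_level_0: "u \<in> tree_aut \<Longrightarrow> sgn_level 0 u = 1"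
  using sign_on_cong[of "{[]}" "{[]}" u id] by (simp add: sgn_level_def)

lemma sgn_level_nonzero: "sgn_level n u \<noteq> 0"
  by (simp add: sgn_level_def sign_on_def)

lemma sgn_level_square [simp]: "sgn_level n u * sgn_level n u = 1"
  by (simp add: sgn_level_def sign_on_def)

text \<open>The sign of \<open>k\<close> occurs on both sides and cancels. Here \<open>k\<close>
  ranges over all permutations of a single level, so as to cover an exchange of letters that is not
  a tree automorphism.\<close>

lemma sgn_level_conj_on:
  assumes "u \<in> tree_aut" "v \<in> tree_aut"
    and k: "bij_betw k {t. length t = n} {t. length t = n}"
    and eq: "\<And>t. length t = n \<Longrightarrow> u (k t) = k (v t)"
  shows "sgn_level n u = sgn_level n v"
proof -
  let ?L = "{t :: bool list. length t = n}"
  have "sign_on ?L u * sign_on ?L k = sign_on ?L (u \<circ> k)"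
    by (intro sign_on_compose[symmetric] bij_betw_level assms finite_level)
  also have "\<dots> = sign_on ?L (k \<circ> v)"
    using eq by (intro sign_on_cong) auto
  also have "\<dots> = sign_on ?L k * sign_on ?L v"
    by (intro sign_on_compose bij_betw_level assms finite_level)
  finally show ?thesis
    by (simp add: sgn_level_def sign_on_def)
qed

lemma sgn_level_conjugate:
  assumes "u \<in> tree_aut" "v \<in> tree_aut" "conjugate u v"
  shows "sgn_level n u = sgn_level n v"
proof -
  obtain g where "g \<in> tree_aut" "u \<circ> g = g \<circ> v"
    using assms(3) by (auto simp: conjugate_def)
  then show ?thesis
    using assms(1,2) by (intro sgn_level_conj_on[of u v g] bij_betw_level) (auto simp: fun_eq_iff)
qed

text \<open>The permutation moves only words ending in 0, where it is the action of \<open>u\<close>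
  transported along the injection \<open>t \<mapsto> t0\<close>; such a transport, extended by the
  identity, keeps the sign.\<close>

lemma sgn_level_pair_id:
  assumes "u \<in> tree_aut"
  shows "sgn_level (Suc n) (pair u id) = sgn_level n u"
proof -
  let ?L = "\<lambda>n. {t :: bool list. length t = n}" and ?f = "\<lambda>t. t @ [False]"
  have inj: "inj_on ?f (?L n)" by (auto simp: inj_on_def)
  have perm: "restrict_id u (?L n) permutes ?L n"
    using bij_betw_level[OF assms] by (rule permutes_restrict_id)
  have "restrict_id (pair u id) (?L (Suc n)) = map_permutation (?L n) ?f (restrict_id u (?L n))"
  proof (rule snoc_ext)
    show "restrict_id (pair u id) (?L (Suc n)) (t @ [c]) =
        map_permutation (?L n) ?f (restrict_id u (?L n)) (t @ [c])" for t c
    proof (cases "t \<in> ?L n \<and> \<not> c")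
      case True
      then have "inv_into (?L n) ?f (t @ [c]) = t"
        using inv_into_f_f[OF inj, of t] by simp
      then show ?thesis
        using True by (auto simp: map_permutation_def restrict_id_def pair_snoc)
    next
      case False
      then show ?thesis
        by (auto simp: map_permutation_def restrict_id_def pair_snoc)
    qed
  qed (auto simp: map_permutation_def restrict_id_def)
  then show ?thesis
    by (simp add: sgn_level_def sign_on_def sign_map_permutation[OF inj perm finite_level])
qed

lemma sgn_level_1_sigma: "sgn_level 1 \<sigma> = -1"
proof -
  have L: "{t :: bool list. length t = 1} = {[False], [True]}"
    by (auto simp: length_Suc_conv)
  have "sgn_level 1 \<sigma> = sign_on {t. length t = 1} (Transposition.transpose [False] [True])"
    unfolding sgn_level_def L by (rule sign_on_cong) (auto simp: \<sigma>_def)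
  then show ?thesis
    unfolding L by (simp add: sign_on_transpose)
qed

text \<open>Exchanging the last two letters conjugates \<open>\<sigma>\<close> to \<open>(\<sigma>,\<sigma>)\<close>, whose sign is a square.\<close>

lemma sgn_level_sigma: "sgn_level (Suc (Suc n)) \<sigma> = 1"
proof -
  define \<tau> :: "bool list \<Rightarrow> bool list"
    where "\<tau> s = butlast (butlast s) @ [last s, last (butlast s)]" for s
  have \<tau>: "\<tau> (t @ [c, d]) = t @ [d, c]" for t c d
    using butlast_snoc[of "t @ [c]" d] by (simp add: \<tau>_def butlast_append)
  have split: "\<exists>t c d. s = t @ [c, d]" if "length s = Suc (Suc n)" for s :: "bool list"
    using that by (cases s rule: rev_cases; cases "butlast s" rule: rev_cases) auto
  have "bij_betw \<tau> {t. length t = Suc (Suc n)} {t. length t = Suc (Suc n)}"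
  proof (rule bij_betw_byWitness[where f' = \<tau>])
    have "\<tau> (\<tau> t) = t \<and> length (\<tau> t) = length t" if "length t = Suc (Suc n)" for t
      using split[OF that] by (auto simp: \<tau>)
    then show "\<forall>t\<in>{t. length t = Suc (Suc n)}. \<tau> (\<tau> t) = t"
      "\<forall>t\<in>{t. length t = Suc (Suc n)}. \<tau> (\<tau> t) = t"
      "\<tau> ` {t. length t = Suc (Suc n)} \<subseteq> {t. length t = Suc (Suc n)}"
      "\<tau> ` {t. length t = Suc (Suc n)} \<subseteq> {t. length t = Suc (Suc n)}"
      by auto
  qed
  moreover have "\<sigma> (\<tau> t) = \<tau> (pair \<sigma> \<sigma> t)" if len: "length t = Suc (Suc n)" for t
  proof -
    obtain t' c d where t: "t = t' @ [c, d]"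
      using split[OF len] by blast
    show ?thesis
      using sigma_snoc[of "t' @ [d]" c] pair_snoc[of \<sigma> \<sigma> "t' @ [c]" d]
      by (simp add: t \<tau> sigma_snoc)
  qed
  ultimately have "sgn_level (Suc (Suc n)) \<sigma> = sgn_level (Suc (Suc n)) (pair \<sigma> \<sigma>)"
    by (intro sgn_level_conj_on[of _ _ \<tau>]) simp_all
  \<comment> \<open>The two factors are conjugate by \<open>\<sigma>\<close>, so their signs
    agree.\<close>
  also have "pair \<sigma> \<sigma> = pair \<sigma> id \<circ> pair id \<sigma>"
    by (simp add: pair_comp)
  also have "sgn_level (Suc (Suc n)) \<dots> =
      sgn_level (Suc (Suc n)) (pair \<sigma> id) * sgn_level (Suc (Suc n)) (pair \<sigma> id)"
    using sgn_level_conjugate[OF _ _ conjugate_root_ext_right[of \<sigma>]]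
    by (simp add: sgn_level_comp root_ext_def)
  finally show ?thesis by simp
qed

text \<open>Only \<open>\<sigma>\<close> moves words on level 1, so the sign there recovers
  \<open>s\<close>.\<close>

lemma sgn_level_1_root_ext:
  "u \<in> tree_aut \<Longrightarrow> sgn_level 1 (root_ext s u) = (if s then -1 else 1)"
  using sgn_level_pair_id[of u 0] sgn_level_1_sigma
  by (simp add: root_ext_def sgn_level_comp sgn_level_0)

text \<open>For \<open>n > 0\<close> the level \<open>Suc n\<close> is at least 2, where
  \<open>\<sigma>\<close> is even.\<close>

lemma sgn_level_Suc_root_ext:
  "u \<in> tree_aut \<Longrightarrow> n > 0 \<Longrightarrow> sgn_level (Suc n) (root_ext s u) = sgn_level n u"
  by (cases n) (simp_all add: root_ext_def sgn_level_comp sgn_level_pair_id sgn_level_sigma)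

section \<open>Word length and descendants\<close>

text \<open>Only positive words are formed; inverses enter by taking a set \<open>S\<close> that
  contains them.\<close>

inductive word_of :: "(bool list \<Rightarrow> bool list) set \<Rightarrow> nat \<Rightarrow> (bool list \<Rightarrow> bool list) \<Rightarrow> bool"
  for S where
  word_of_id: "word_of S 0 id"
| word_of_step: "s \<in> S \<Longrightarrow> word_of S n w \<Longrightarrow> word_of S (Suc n) (s \<circ> w)"

lemma word_of_0_iff [simp]: "word_of S 0 w \<longleftrightarrow> w = id"
  by (auto elim: word_of.cases intro: word_of_id)

lemma word_of_comp: "word_of S m u \<Longrightarrow> word_of S n v \<Longrightarrow> word_of S (m + n) (u \<circ> v)"
  by (induction rule: word_of.induct) (auto simp: comp_assoc intro: word_of_step)

lemma word_of_generator: "s \<in> S \<Longrightarrow> word_of S 1 s"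
  using word_of_step[OF _ word_of_id, of s S] by simp

lemma word_of_in_tree_aut: "word_of S n w \<Longrightarrow> S \<subseteq> tree_aut \<Longrightarrow> w \<in> tree_aut"
  by (induction rule: word_of.induct) auto

text \<open>Each letter carries a single letter into exactly one of its two entries. This controls
  the lengths of descendants.\<close>

definition self_similar :: "(bool list \<Rightarrow> bool list) set \<Rightarrow> bool" where
  "self_similar S \<longleftrightarrow> S \<subseteq> tree_aut \<and>
    (\<forall>s\<in>S. \<exists>c\<in>S. s \<in> {pair c id, pair id c, pair c id \<circ> \<sigma>, pair id c \<circ> \<sigma>})"

text \<open>Every letter of the word contributes one letter to one entry, while
  \<open>\<sigma>\<close> merely exchanges the entries. Hence the lengths of the entries add up to
  \<open>n\<close> exactly.\<close>

lemma word_of_decomp: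
  assumes "self_similar S" "word_of S n w"
  shows "\<exists>p q u v. word_of S p u \<and> word_of S q v \<and> p + q = n \<and>
    (w = pair u v \<or> w = pair u v \<circ> \<sigma>)"
  using assms(2)
proof (induction rule: word_of.induct)
  case word_of_id
  have "word_of S 0 id \<and> word_of S 0 id \<and> 0 + 0 = (0::nat) \<and>
      (id = pair id id \<or> id = pair id id \<circ> \<sigma>)"
    by simp
  then show ?case by blast
next
  case (word_of_step s n w)
  then obtain p q u v where uv: "word_of S p u" "word_of S q v" "p + q = n"
      "w = pair u v \<or> w = pair u v \<circ> \<sigma>"
    by blast
  obtain c where c: "c \<in> S"
      "s \<in> {pair c id, pair id c, pair c id \<circ> \<sigma>, pair id c \<circ> \<sigma>}"
    using assms(1) word_of_step.hyps(1) by (auto simp: self_similar_def)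
  have pair_sigma_comp: "pair d e \<circ> (pair u v \<circ> \<sigma>) = pair (d \<circ> u) (e \<circ> v) \<circ> \<sigma>"
    "pair d e \<circ> \<sigma> \<circ> pair u v = pair (d \<circ> v) (e \<circ> u) \<circ> \<sigma>"
    "pair d e \<circ> \<sigma> \<circ> (pair u v \<circ> \<sigma>) = pair (d \<circ> v) (e \<circ> u)" for d e
  proof -
    show "pair d e \<circ> (pair u v \<circ> \<sigma>) = pair (d \<circ> u) (e \<circ> v) \<circ> \<sigma>"
      by (simp only: pair_comp flip: comp_assoc)
    have "pair d e \<circ> (\<sigma> \<circ> pair u v) = pair (d \<circ> v) (e \<circ> u) \<circ> \<sigma>"
      unfolding sigma_pair by (simp only: pair_comp flip: comp_assoc)
    then show swap: "pair d e \<circ> \<sigma> \<circ> pair u v = pair (d \<circ> v) (e \<circ> u) \<circ> \<sigma>"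
      by (simp only: comp_assoc)
    have "pair d e \<circ> \<sigma> \<circ> (pair u v \<circ> \<sigma>) = pair (d \<circ> v) (e \<circ> u) \<circ> (\<sigma> \<circ> \<sigma>)"
      using swap by (simp only: flip: comp_assoc)
    then show "pair d e \<circ> \<sigma> \<circ> (pair u v \<circ> \<sigma>) = pair (d \<circ> v) (e \<circ> u)"
      by simp
  qed
  have factorI: "\<exists>p q u v. word_of S p u \<and> word_of S q v \<and> p + q = Suc n \<and>
      (s \<circ> w = pair u v \<or> s \<circ> w = pair u v \<circ> \<sigma>)"
    if "word_of S p u" "word_of S q v" "s \<circ> w = pair u v \<or> s \<circ> w = pair u v \<circ> \<sigma>" "p + q = Suc n"
    for p q u v
    using that by blast
  have cu: "word_of S (Suc p) (c \<circ> u)" and cv: "word_of S (Suc q) (c \<circ> v)"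
    using c(1) uv by (auto intro: word_of.word_of_step)
  \<comment> \<open>In the first two cases \<open>s\<close> fixes the subtrees at the root; in the
    last two its factor \<open>\<sigma>\<close> exchanges \<open>u\<close> and \<open>v\<close>
    before \<open>c\<close> is attached.\<close>
  consider
    "s \<circ> w = pair (c \<circ> u) v \<or> s \<circ> w = pair (c \<circ> u) v \<circ> \<sigma>"
  | "s \<circ> w = pair u (c \<circ> v) \<or> s \<circ> w = pair u (c \<circ> v) \<circ> \<sigma>"
  | "s \<circ> w = pair v (c \<circ> u) \<or> s \<circ> w = pair v (c \<circ> u) \<circ> \<sigma>"
  | "s \<circ> w = pair (c \<circ> v) u \<or> s \<circ> w = pair (c \<circ> v) u \<circ> \<sigma>"
    using c(2) uv(4) by (elim insertE emptyE disjE) (simp_all add: pair_sigma_comp pair_comp)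
  then show ?case
  proof cases
    case 1
    then show ?thesis by (rule factorI[OF cu uv(2)]) (use uv(3) in simp)
  next
    case 2
    then show ?thesis by (rule factorI[OF uv(1) cv]) (use uv(3) in simp)
  next
    case 3
    then show ?thesis by (rule factorI[OF uv(2) cu]) (use uv(3) in simp)
  next
    case 4
    then show ?thesis by (rule factorI[OF cv uv(1)]) (use uv(3) in simp)
  qed
qed

definition word_length :: "(bool list \<Rightarrow> bool list) set \<Rightarrow> (bool list \<Rightarrow> bool list) \<Rightarrow> nat" where
  "word_length S w = (LEAST n. word_of S n w)"

lemma word_of_word_length: "word_of S n w \<Longrightarrow> word_of S (word_length S w) w"
  unfolding word_length_def by (rule LeastI)

lemma word_length_le: "word_of S n w \<Longrightarrow> word_length S w \<le> n"
  unfolding word_length_def by (rule Least_le)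

lemma first_descendants_pair:
  "d \<in> first_descendants (pair u v) \<Longrightarrow> d = u \<or> d = v"
  by (auto simp: first_descendants_def pair_eq_iff pair_neq_pair_sigma)

lemma first_descendants_pair_sigma:
  "d \<in> first_descendants (pair u v \<circ> \<sigma>) \<Longrightarrow> d = u \<circ> v"
  by (auto simp: first_descendants_def pair_sigma_eq_iff pair_neq_pair_sigma[symmetric])

text \<open>A shortest word for \<open>w\<close> is split into its entries. If \<open>d\<close> is
  one entry and has full length, no letters are left for the other, which is therefore
  \<open>id\<close>; if \<open>d\<close> is the product of both, the swap case of conjugacy
  applies.\<close>

lemma first_descendants_word_length:
  assumes "self_similar S" "word_of S n w" "d \<in> first_descendants w"
  shows "(\<exists>m. word_of S m d) \<and> word_length S d \<le> word_length S w"
    and "word_length S d = word_length S w \<Longrightarrow> \<exists>s. conjugate w (root_ext s d)"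
proof -
  obtain p q u v where uv: "word_of S p u" "word_of S q v" "p + q = word_length S w"
      "w = pair u v \<or> w = pair u v \<circ> \<sigma>"
    using word_of_decomp[OF assms(1) word_of_word_length[OF assms(2)]] by blast
  have d: "w = pair u v \<and> d = u \<or> w = pair u v \<and> d = v \<or> w = pair u v \<circ> \<sigma> \<and> d = u \<circ> v"
    using uv(4) assms(3) first_descendants_pair first_descendants_pair_sigma by blast
  have aut: "u \<in> tree_aut" "v \<in> tree_aut"
    using uv assms(1) word_of_in_tree_aut by (auto simp: self_similar_def)
  have uv_word: "word_of S (p + q) (u \<circ> v)"
    using uv by (intro word_of_comp)
  show "(\<exists>m. word_of S m d) \<and> word_length S d \<le> word_length S w"
    using d uv(1-3) uv_word word_length_le[OF uv(1)] word_length_le[OF uv(2)]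
      word_length_le[OF uv_word] by auto
  assume eq: "word_length S d = word_length S w"
  from d show "\<exists>s. conjugate w (root_ext s d)"
  proof (elim disjE conjE)
    assume w: "w = pair u v" "d = u"
    then have "q = 0" using eq uv(3) word_length_le[OF uv(1)] by simp
    then have "w = root_ext False d" using w uv(2) by (simp add: root_ext_def)
    then show ?thesis using conjugate_refl by metis
  next
    assume w: "w = pair u v" "d = v"
    then have "p = 0" using eq uv(3) word_length_le[OF uv(2)] by simp
    then show ?thesis using w uv(1) conjugate_root_ext_right by auto
  next
    assume "w = pair u v \<circ> \<sigma>" "d = u \<circ> v"
    then show ?thesis using conjugate_root_ext_swap[OF aut(2)] by blast
  qed
qed

section \<open>Descendant cycles and periodicity\<close>

lemma descendants_rtrancl:
  "d \<in> descendants n w \<Longrightarrow> (w, d) \<in> {(c, d). d \<in> first_descendants c}\<^sup>*"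
  by (induction n arbitrary: d) (auto intro: rtrancl_into_rtrancl)

text \<open>\<open>Desc\<close> starts with the first descendants, so the chain is nonempty; thus
  \<open>w \<in> Desc w\<close> gives a genuine cycle.\<close>

lemma Desc_trancl: "d \<in> Desc w \<Longrightarrow> (w, d) \<in> {(c, d). d \<in> first_descendants c}\<^sup>+"
proof -
  assume "d \<in> Desc w"
  then obtain n where "d \<in> descendants (Suc n) w"
    unfolding Desc_def by (auto dest!: Suc_le_D)
  then obtain c where "c \<in> descendants n w" "d \<in> first_descendants c"
    by auto
  then show ?thesis
    using descendants_rtrancl by (blast intro: rtrancl_into_trancl1)
qed

lemma word_length_rtrancl:
  assumes "self_similar S" "(c, d) \<in> {(c, d). d \<in> first_descendants c}\<^sup>*" "\<exists>n. word_of S n c"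
  shows "(\<exists>n. word_of S n d) \<and> word_length S d \<le> word_length S c"
  using assms(2)
proof (induction rule: rtrancl_induct)
  case (step e f)
  then show ?case
    using first_descendants_word_length(1)[OF assms(1), of _ e f] by force
qed (use assms(3) in simp)

section \<open>The cyclic shift of indices and its effect on \<open>J\<close>\<close>

definition cyclic_pred :: "nat \<Rightarrow> nat \<Rightarrow> nat" where
  "cyclic_pred r i = (if i = 1 then r else i - 1)"

lemma cyclic_pred_1: "cyclic_pred r (Suc 0) = r"
  by (simp add: cyclic_pred_def)

lemma cyclic_pred_bij: "r > 0 \<Longrightarrow> bij_betw (cyclic_pred r) {1..r} {1..r}"
  by (rule bij_betw_byWitness[where f' = "\<lambda>i. if i = r then 1 else i + 1"])
    (auto simp: cyclic_pred_def)

lemma cyclic_pred_in: "i \<in> {1..r} \<Longrightarrow> cyclic_pred r i \<in> {1..r}"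
  by (auto simp: cyclic_pred_def)

lemma cyclic_pred_funpow: "k < i \<Longrightarrow> (cyclic_pred r ^^ k) i = i - k"
  by (induction k) (auto simp: cyclic_pred_def)

text \<open>It takes \<open>i - 1\<close> steps down to 1, one step around to \<open>r\<close>, and
  \<open>r - i\<close> steps back to \<open>i\<close>.\<close>

lemma cyclic_pred_period:
  assumes "i \<in> {1..r}"
  shows "(cyclic_pred r ^^ r) i = i"
proof -
  have "(cyclic_pred r ^^ (i - 1)) i = 1"
    using assms cyclic_pred_funpow[of "i - 1" i r] by simp
  then have "(cyclic_pred r ^^ Suc (i - 1)) i = r"
    by (simp add: cyclic_pred_def)
  moreover have "Suc (i - 1) = i"
    using assms by simp
  ultimately have "(cyclic_pred r ^^ i) i = r"
    by (simp only:)
  moreover have "(cyclic_pred r ^^ (r - i)) r = i"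
    using assms cyclic_pred_funpow[of "r - i" r r] by simp
  moreover have "cyclic_pred r ^^ r = (cyclic_pred r ^^ (r - i)) \<circ> (cyclic_pred r ^^ i)"
    using assms by (simp flip: funpow_add)
  ultimately show ?thesis by simp
qed

text \<open>Periodicity is what treats the index 1: the sign of \<open>d\<close> on level
  \<open>r\<close> is that of \<open>w\<close> on level \<open>r + 1\<close>, hence on level
  1.\<close>

lemma J_cyclic_pred:
  assumes "r > 0" and i: "\<And>i. i \<in> {1..r} \<Longrightarrow> sgn_level (Suc i) w = sgn_level i d"
    and period: "sgn_level (Suc r) w = sgn_level 1 w"
  shows "J r d = cyclic_pred r ` J r w"
proof -
  have "sgn_level (cyclic_pred r i) d = sgn_level i w" if "i \<in> {1..r}" for i
    using that i[of "cyclic_pred r i"] cyclic_pred_in[OF that] period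
    by (auto simp: cyclic_pred_def)
  then have "J r w = {i \<in> {1..r}. sgn_level (cyclic_pred r i) d = -1}"
    by (auto simp: J_def)
  moreover have "cyclic_pred r ` {1..r} = {1..r}"
    using cyclic_pred_bij[OF \<open>r > 0\<close>] by (simp add: bij_betw_def)
  then have "J r d = {j \<in> cyclic_pred r ` {1..r}. sgn_level j d = -1}"
    by (simp add: J_def)
  ultimately show ?thesis by (simp only: Compr_image_eq)
qed

section \<open>Ordered products and the recursion for products of the \<open>a i\<close>\<close>

abbreviation comp_list :: "('i \<Rightarrow> 'a \<Rightarrow> 'a) \<Rightarrow> 'i list \<Rightarrow> 'a \<Rightarrow> 'a" where
  "comp_list a js \<equiv> foldr (\<lambda>i p. a i \<circ> p) js id"

lemma comp_list_append: "comp_list a (is @ js) = comp_list a is \<circ> comp_list a js"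
  by (induction "is") (simp_all add: comp_assoc)

lemma comp_list_in_tree_aut: "(\<And>i. i \<in> set js \<Longrightarrow> a i \<in> tree_aut) \<Longrightarrow> comp_list a js \<in> tree_aut"
  by (induction js) simp_all

text \<open>Distinctness allows at most one factor \<open>a 1\<close>. Moving its
  \<open>\<sigma>\<close> to the right end sends the factors after it to the second entry, and the
  swap conjugation multiplies the two entries in the original order. So any order of the indices is
  admissible.\<close>

lemma comp_list_conjugate:
  assumes a: "\<And>i. i \<in> {1..r} \<Longrightarrow> a i \<in> tree_aut"
    and a1: "a 1 = pair (a r) id \<circ> \<sigma>"
    and a_rec: "\<And>i. i \<in> {2..r} \<Longrightarrow> a i = pair (a (i - 1)) id"
    and js: "distinct js" "set js \<subseteq> {1..r}"
  shows "conjugate (comp_list a js) (root_ext (1 \<in> set js) (comp_list a (map (cyclic_pred r) js)))"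
proof -
  let ?p = "\<lambda>js. comp_list a (map (cyclic_pred r) js)"
  have a_pred: "a (cyclic_pred r i) \<in> tree_aut" if "i \<in> set js" for i
    using that a cyclic_pred_in js(2) by blast
  have nonswap: "comp_list a js = pair (?p js) id" if "1 \<notin> set js" "set js \<subseteq> {1..r}" for js
    using that
  proof (induction js)
    case (Cons i js)
    then have "i \<in> {2..r}" by force
    then have "a i = pair (a (cyclic_pred r i)) id"
      using a_rec[of i] by (simp add: cyclic_pred_def)
    moreover have "comp_list a js = pair (?p js) id"
      by (rule Cons.IH) (use Cons.prems in auto)
    ultimately have "comp_list a (i # js) = pair (?p (i # js)) id"
      by (simp add: pair_comp)
    then show ?case .
  qed simp
  show ?thesis
  proof (cases "1 \<in> set js")
    case False
    then show ?thesis
      using nonswap[OF False js(2)] by (simp add: root_ext_def)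
  next
    case True
    then obtain xs ys where split: "js = xs @ 1 # ys" "1 \<notin> set xs" "1 \<notin> set ys"
      using js(1) by (metis split_list distinct_append distinct.simps(2) not_distinct_conv_prefix
        disjoint_iff list.set_intros(1))
    have "comp_list a js = comp_list a xs \<circ> (a 1 \<circ> comp_list a ys)"
      unfolding split(1) comp_list_append by simp
    also have "\<dots> = pair (?p xs) id \<circ> (pair (a r) id \<circ> \<sigma> \<circ> pair (?p ys) id)"
      using nonswap[of xs] nonswap[of ys] split js(2) unfolding a1 by simp
    also have "\<dots> = pair (?p xs \<circ> a r) (?p ys) \<circ> \<sigma>"
      by (simp add: comp_assoc sigma_pair) (simp add: pair_comp flip: comp_assoc)
    finally have js_eq: "comp_list a js = pair (?p xs \<circ> a r) (?p ys) \<circ> \<sigma>" .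
    have "conjugate (pair (?p xs \<circ> a r) (?p ys) \<circ> \<sigma>) (root_ext True (?p xs \<circ> a r \<circ> ?p ys))"
    proof (intro conjugate_root_ext_swap comp_list_in_tree_aut)
      show "a i \<in> tree_aut" if "i \<in> set (map (cyclic_pred r) ys)" for i
        using that a_pred split(1) by auto
    qed
    moreover have "?p xs \<circ> a r \<circ> ?p ys = ?p js"
      unfolding split(1) map_append comp_list_append by (simp add: cyclic_pred_1 comp_assoc)
    ultimately show ?thesis
      unfolding js_eq using True by simp
  qed
qed

theorem proposition4p15:
  fixes r :: nat and x :: "nat \<Rightarrow> bool"
    and a b :: "nat \<Rightarrow> bool list \<Rightarrow> bool list"
    and w :: "bool list \<Rightarrow> bool list" and js :: "nat list"
  assumes "r > 0"
    and "\<And>i. i \<in> {1..r} \<Longrightarrow> b i \<in> carrier W"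
    and "b 1 = pair \<one>\<^bsub>W\<^esub> (b r) \<otimes>\<^bsub>W\<^esub> \<sigma>"
    and "\<And>i. i \<in> {2..r} \<Longrightarrow> x i = False \<Longrightarrow> b i = pair (b (i - 1)) \<one>\<^bsub>W\<^esub>"
    and "\<And>i. i \<in> {2..r} \<Longrightarrow> x i = True \<Longrightarrow> b i = pair \<one>\<^bsub>W\<^esub> (b (i - 1))"
    and "\<And>i. i \<in> {1..r} \<Longrightarrow> a i \<in> carrier W"
    and "a 1 = pair (a r) \<one>\<^bsub>W\<^esub> \<otimes>\<^bsub>W\<^esub> \<sigma>"
    and "\<And>i. i \<in> {2..r} \<Longrightarrow> a i = pair (a (i - 1)) \<one>\<^bsub>W\<^esub>"
    and "w \<in> generate W (b ` {1..r})"
    and "\<Phi>_irreducible w"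
    and "distinct js" and "set js = J r w"
  shows "\<exists>g\<in>carrier W.
    w = g \<otimes>\<^bsub>W\<^esub> foldr (\<lambda>i p. a i \<otimes>\<^bsub>W\<^esub> p) js \<one>\<^bsub>W\<^esub> \<otimes>\<^bsub>W\<^esub> inv\<^bsub>W\<^esub> g"
proof -
  have b: "b i \<in> tree_aut" if "i \<in> {1..r}" for i
    using assms(2)[OF that] by simp
  have a: "a i \<in> tree_aut" if "i \<in> {1..r}" for i
    using assms(6)[OF that] by simp
  have b1: "b 1 = pair id (b r) \<circ> \<sigma>"
    using assms(3) by simp
  have b_rec: "b i = pair (b (i - 1)) id \<or> b i = pair id (b (i - 1))" if "i \<in> {2..r}" for i
    using assms(4,5)[OF that] by (cases "x i") auto
  have a1: "a 1 = pair (a r) id \<circ> \<sigma>"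
    using assms(7) by simp
  have a_rec: "a i = pair (a (i - 1)) id" if "i \<in> {2..r}" for i
    using assms(8)[OF that] by simp

  \<comment> \<open>Inverses are included, so that words over \<open>S\<close> represent every
    element of the group.\<close>
  define S where "S = (\<Union>i\<in>{1..r}. {b i, inv\<^bsub>W\<^esub> b i})"
  have S: "S \<subseteq> tree_aut" using b by (auto simp: S_def)
  have inv_eq: "inv\<^bsub>W\<^esub> u = v" if "v \<circ> u = id" "u \<in> tree_aut" "v \<in> tree_aut" for u v
    using group.inv_equality[OF group_W, of v u] that by simp
  have S_step: "\<exists>c\<in>S. s \<in> {pair c id, pair id c, pair c id \<circ> \<sigma>, pair id c \<circ> \<sigma>}"
    if s: "s \<in> {b i, inv\<^bsub>W\<^esub> b i}" and i: "i \<in> {1..r}" for s i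
  proof -
    let ?c = "b (cyclic_pred r i)"
    have c: "?c \<in> S" "inv\<^bsub>W\<^esub> ?c \<in> S" and caut: "?c \<in> tree_aut"
      using cyclic_pred_in[OF i] b by (auto simp: S_def)
    show ?thesis
    proof (cases "i = 1")
      case True
      \<comment> \<open>The inverse of \<open>(1,c)\<sigma>\<close> is \<open>(c',1)\<sigma>\<close>
        with \<open>c'\<close> inverse to \<open>c\<close>: the nontrivial entry changes
        sides.\<close>
      have "pair (inv\<^bsub>W\<^esub> ?c) id \<circ> \<sigma> \<circ> (pair id ?c \<circ> \<sigma>) =
          pair (inv\<^bsub>W\<^esub> ?c) id \<circ> pair ?c id \<circ> (\<sigma> \<circ> \<sigma>)"
        by (simp only: comp_assoc) (simp only: sigma_pair flip: comp_assoc)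
      then have "inv\<^bsub>W\<^esub> b i = pair (inv\<^bsub>W\<^esub> ?c) id \<circ> \<sigma>"
        using True b1 caut by (intro inv_eq) (simp_all add: cyclic_pred_def pair_comp)
      then show ?thesis
        using s c True b1 by (auto simp: cyclic_pred_def)
    next
      case False
      then have "b i = pair ?c id \<or> b i = pair id ?c"
        using b_rec[of i] i by (auto simp: cyclic_pred_def)
      moreover have "inv\<^bsub>W\<^esub> pair ?c id = pair (inv\<^bsub>W\<^esub> ?c) id"
        "inv\<^bsub>W\<^esub> pair id ?c = pair id (inv\<^bsub>W\<^esub> ?c)"
        using caut by (auto intro!: inv_eq simp: pair_comp)
      ultimately show ?thesis
        using s c by auto
    qed
  qed
  have ss: "self_similar S"
    unfolding self_similar_def using S S_step by (auto simp: S_def)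
  have w_word: "\<exists>n. word_of S n w"
    using assms(9)
  proof (induction rule: generate.induct)
    case one
    have "word_of S 0 \<one>\<^bsub>W\<^esub>" by simp
    then show ?case by blast
  next
    case (incl h)
    then show ?case by (auto simp: S_def intro!: exI[of _ 1] word_of_generator)
  next
    case (inv h)
    then show ?case by (auto simp: S_def intro!: exI[of _ 1] word_of_generator)
  next
    case (eng h1 h2)
    then obtain m n where "word_of S m h1" "word_of S n h2"
      by blast
    then have "word_of S (m + n) (h1 \<otimes>\<^bsub>W\<^esub> h2)"
      by (simp add: word_of_comp)
    then show ?case by blast
  qed

  \<comment> \<open>Up to conjugacy the choice of side encoded by \<open>x\<close> disappears, and
    the \<open>b i\<close> satisfy the recursion of the \<open>a i\<close>.\<close>
  have b_ext: "conjugate (b i) (root_ext (i = 1) (b (cyclic_pred r i)))" if i: "i \<in> {1..r}" for i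
  proof (cases "i = 1")
    case True
    then show ?thesis
      using conjugate_root_ext_swap[OF b[of r], of id] b1 assms(1) by (simp add: cyclic_pred_def)
  next
    case False
    then show ?thesis
      using b_rec[of i] i conjugate_root_ext_right by (auto simp: cyclic_pred_def root_ext_def)
  qed
  \<comment> \<open>Each level gained moves the index one step back around the cycle; after
    \<open>r\<close> steps it returns, which gives the period \<open>r\<close> of the signs.\<close>
  have sgn_b: "sgn_level (Suc k) (b i) = sgn_level 1 (b ((cyclic_pred r ^^ k) i))"
    if "i \<in> {1..r}" for k i
    using that
  proof (induction k arbitrary: i)
    case (Suc k)
    have "sgn_level (Suc (Suc k)) (b i) = sgn_level (Suc k) (b (cyclic_pred r i))"
      using sgn_level_conjugate[OF _ _ b_ext[OF Suc.prems]] b cyclic_pred_in[OF Suc.prems] Suc.prems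
      by (simp add: sgn_level_Suc_root_ext del: atLeastAtMost_iff)
    then show ?case
      using Suc.IH[OF cyclic_pred_in[OF Suc.prems]] by (simp add: funpow_swap1)
  qed simp
  have sgn_b_period: "sgn_level (Suc r) (b i) = sgn_level 1 (b i)" if "i \<in> {1..r}" for i
    using sgn_b[OF that, of r] cyclic_pred_period[OF that] by simp
  have sgn_inv: "sgn_level n (inv\<^bsub>W\<^esub> u) = sgn_level n u" if "u \<in> tree_aut" for n u
  proof -
    have "sgn_level n u * sgn_level n (inv\<^bsub>W\<^esub> u) = sgn_level n u * sgn_level n u"
      using that by (simp flip: sgn_level_comp)
    then show ?thesis
      unfolding mult_cancel_left by (simp add: sgn_level_nonzero)
  qed
  have sgn_period: "sgn_level (Suc r) u = sgn_level 1 u" if "word_of S n u" for n u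
    using that
  proof (induction rule: word_of.induct)
    case (word_of_step s n u)
    have "sgn_level (Suc r) s = sgn_level 1 s"
      using word_of_step(1) sgn_b_period sgn_inv b by (auto simp: S_def)
    moreover have "s \<in> tree_aut" "u \<in> tree_aut"
      using word_of_step(1) S word_of_in_tree_aut[OF word_of_step(2) S] by auto
    ultimately show ?case
      using word_of_step.IH by (simp only: sgn_level_comp)
  qed (simp only: sgn_level_id)

  let ?step = "{(c, d). d \<in> first_descendants c}"
  \<comment> \<open>The elements on descendant cycles through \<open>w\<close>: reachable from
    \<open>w\<close> and leading back to it.\<close>
  define D where "D = {d. (w, d) \<in> ?step\<^sup>* \<and> (d, w) \<in> ?step\<^sup>+}"
  have w_cycle: "(w, w) \<in> ?step\<^sup>+"
    using assms(10) Desc_trancl by (auto simp: \<Phi>_irreducible_def)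
  \<comment> \<open>Length cannot grow from \<open>w\<close> to \<open>d\<close> or from
    \<open>d\<close> to \<open>w\<close>, so it is the same for both.\<close>
  have D_word: "(\<exists>n. word_of S n d) \<and> word_length S d = word_length S w" if "d \<in> D" for d
  proof -
    have "(\<exists>n. word_of S n d) \<and> word_length S d \<le> word_length S w"
      using that word_length_rtrancl[OF ss _ w_word] by (auto simp: D_def)
    moreover from this have "word_length S w \<le> word_length S d"
      using that word_length_rtrancl[OF ss trancl_into_rtrancl] by (auto simp: D_def)
    ultimately show ?thesis by auto
  qed
  have D_aut: "d \<in> tree_aut" if "d \<in> D" for d
    using D_word[OF that] word_of_in_tree_aut[OF _ S] by blast
  have D_step: "\<exists>d'\<in>D. conjugate d (root_ext (1 \<in> J r d) d') \<and> J r d' = cyclic_pred r ` J r d"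
    if d: "d \<in> D" for d
  proof -
    obtain d' where d': "d' \<in> first_descendants d" "(d', w) \<in> ?step\<^sup>*"
      using d by (auto simp: D_def dest: tranclD)
    \<comment> \<open>If \<open>d'\<close> is \<open>w\<close> itself, the path back is empty;
      appending the cycle \<open>w_cycle\<close> makes it nonempty.\<close>
    have "(w, d') \<in> ?step\<^sup>*" "(d', w) \<in> ?step\<^sup>+"
      using d d' w_cycle by (auto simp: D_def intro: rtrancl_into_rtrancl rtrancl_trancl_trancl)
    then have D: "d' \<in> D" by (simp add: D_def)
    obtain n where n: "word_of S n d" using D_word[OF d] by blast
    obtain s where s: "conjugate d (root_ext s d')"
      using first_descendants_word_length(2)[OF ss n d'(1)] D_word d D by auto
    note sgn = sgn_level_conjugate[OF D_aut[OF d] root_ext_in_tree_aut[OF D_aut[OF D]] s]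
    have "1 \<in> J r d \<longleftrightarrow> s"
      using sgn[of 1] sgn_level_1_root_ext[OF D_aut[OF D]] assms(1) by (auto simp: J_def)
    moreover have "J r d' = cyclic_pred r ` J r d"
      using sgn sgn_level_Suc_root_ext[OF D_aut[OF D]]
      by (intro J_cyclic_pred assms(1) sgn_period[OF n]) auto
    ultimately show ?thesis using s D by auto
  qed

  define R where "R d p \<longleftrightarrow> (\<exists>js. d \<in> D \<and> distinct js \<and> set js = J r d \<and> p = comp_list a js)"
    for d p
  have "conjugate w (comp_list a js)"
  proof (rule conjugate_coinduct[of R])
    show "R w (comp_list a js)"
      using assms(11,12) w_cycle by (auto simp: R_def D_def)
    fix d p
    assume "R d p"
    then obtain ks where ks: "d \<in> D" "distinct ks" "set ks = J r d" "p = comp_list a ks"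
      by (auto simp: R_def)
    have sub: "set ks \<subseteq> {1..r}" using ks(3) by (auto simp: J_def)
    obtain d' where d': "d' \<in> D" "conjugate d (root_ext (1 \<in> J r d) d')"
        "J r d' = cyclic_pred r ` J r d"
      using D_step[OF ks(1)] by blast
    have "distinct (map (cyclic_pred r) ks)"
      using ks(2) sub bij_betw_imp_inj_on[OF cyclic_pred_bij[OF assms(1)]]
      by (auto simp: distinct_map intro: inj_on_subset)
    then have "R d' (comp_list a (map (cyclic_pred r) ks))"
      using d' ks(3) by (auto simp: R_def)
    moreover have "conjugate p (root_ext (1 \<in> J r d) (comp_list a (map (cyclic_pred r) ks)))"
      using comp_list_conjugate[OF a a1 a_rec ks(2) sub] ks(3,4) by simp
    moreover have "p \<in> tree_aut"
      unfolding ks(4) using sub a by (intro comp_list_in_tree_aut) blast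
    ultimately show "d \<in> tree_aut \<and> p \<in> tree_aut \<and>
        (\<exists>s u u'. R u u' \<and> conjugate d (root_ext s u) \<and> conjugate p (root_ext s u'))"
      using d' D_aut[OF ks(1)] by blast
  qed
  from conjugate_W[OF this] show ?thesis by simp
qed

end
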